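(* Let $A=LL^*\in M_n(\mathbb{C})$, where $L=(L_{ij})$ is lower triangular, with $|L_{kj}|\le \epsilon_n$ for all $k,j$ with $j\neq 1$. Then $\bar d^G_\chi(A)\le \operatorname{per}(A)$ for any group $G\le S_n$ and any irreducible character $\chi$ of $G$.
   Context: Characters are characters of finite-dimensional complex representations. For $G\le S_n$, a character $\chi$ of $G$ and $A=(A_{ij})\in M_n(\mathbb{C})$, put $d^G_\chi(A)=\sum_{g\in G}\chi(g)\prod_{i=1}^n A_{i\,g(i)}$ and $\bar d^G_\chi(A)=\frac{1}{\chi(e)}d^G_\chi(A)$, where $e$ is the identity; $\operatorname{per}(A)=\sum_{\sigma\in S_n}\prod_{i=1}^nA_{i\sigma(i)}$. For $n>3$, the number $\epsilon_n$ (which depends on the first column of $L$) is $$\epsilon_n=\min\left\{\frac{\alpha}{\alpha_0^{\,n-1}}\sqrt{\frac{2}{3\,n!\,M_n}},\,1\right\},\qquad \alpha=\prod_{i=1}^n|L_{i1}|,\qquad \alpha_0=\max_{1\le i\le n}|L_{i1}|,$$ where $$M_n= \begin{cases} n^n-(n-1)^n-n!-n^{\frac{n-4}{2}}\left(\frac{n-2}{2}\right)^{\frac{n+2}{2}}\left(\frac{n+4}{2}\right)-1, & n \text{ even},\\ n^n-(n-1)^n-n!-n^{\frac{n-5}{2}}\left(\frac{n-1}{2}\right)^{\frac{n+1}{2}}\left(\frac{n+3}{2}\right)-1, & n \text{ odd}. \end{cases}$$ For $n\le 3$ no value $\epsilon_n$ is defined and no condition on $L$ is needed: the inequality is taken as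 known for every positive semi-definite matrix of size $n\le 3$. *)

theory Defs
  imports
    "HOL-Algebra.Sym_Groups"
    "Jordan_Normal_Form.VS_Connect"
    "Jordan_Normal_Form.Schur_Decomposition"
begin

text \<open>
  A representation of degree m is a homomorphism into the unit group of the ring of
  complex m by m matrices, i.e. into GL(m, C); it acts on column vectors.
\<close>

definition representation ::
    "('g, 'b) monoid_scheme \<Rightarrow> nat \<Rightarrow> ('g \<Rightarrow> complex mat) \<Rightarrow> bool" where
  "representation H m \<rho> \<longleftrightarrow> \<rho> \<in> hom H (units_of (ring_mat TYPE(complex) m ()))"

definition invariant_subspace ::
    "('g, 'b) monoid_scheme \<Rightarrow> nat \<Rightarrow> ('g \<Rightarrow> complex mat) \<Rightarrow> complex vec set \<Rightarrow> bool" where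
  "invariant_subspace H m \<rho> W \<longleftrightarrow>
     VectorSpace.subspace class_ring W (module_vec TYPE(complex) m) \<and>
     (\<forall>g \<in> carrier H. \<forall>v \<in> W. \<rho> g *\<^sub>v v \<in> W)"

definition irreducible_representation ::
    "('g, 'b) monoid_scheme \<Rightarrow> nat \<Rightarrow> ('g \<Rightarrow> complex mat) \<Rightarrow> bool" where
  "irreducible_representation H m \<rho> \<longleftrightarrow>
     representation H m \<rho> \<and> 0 < m \<and>
     (\<forall>W. invariant_subspace H m \<rho> W \<longrightarrow> W = {0\<^sub>v m} \<or> W = carrier_vec m)"

definition mat_trace :: "'a :: comm_monoid_add mat \<Rightarrow> 'a" where
  "mat_trace A = (\<Sum>i < dim_row A. A $$ (i, i))"

text \<open>Only the values of \<open>\<chi>\<close> on the carrier matter.\<close>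

definition irreducible_character ::
    "('g, 'b) monoid_scheme \<Rightarrow> ('g \<Rightarrow> complex) \<Rightarrow> bool" where
  "irreducible_character H \<chi> \<longleftrightarrow>
     (\<exists>m \<rho>. irreducible_representation H m \<rho> \<and> (\<forall>g \<in> carrier H. \<chi> g = mat_trace (\<rho> g)))"

text \<open>
  The elements of \<^term>\<open>sym_group n\<close> permute \<open>{1..n}\<close>, whereas matrix indices
  start at 0; hence the index shifts.
\<close>

definition gen_matrix_function ::
    "(nat \<Rightarrow> nat) set \<Rightarrow> ((nat \<Rightarrow> nat) \<Rightarrow> complex) \<Rightarrow> complex mat \<Rightarrow> complex" where
  "gen_matrix_function G \<chi> A =
     (\<Sum>g \<in> G. \<chi> g * (\<Prod>i = 1..dim_row A. A $$ (i - 1, g i - 1)))"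

definition normalized_gen_matrix_function ::
    "(nat \<Rightarrow> nat) set \<Rightarrow> ((nat \<Rightarrow> nat) \<Rightarrow> complex) \<Rightarrow> complex mat \<Rightarrow> complex" where
  "normalized_gen_matrix_function G \<chi> A = 1 / \<chi> id * gen_matrix_function G \<chi> A"

definition permanent :: "complex mat \<Rightarrow> complex" where
  "permanent A =
     (\<Sum>\<sigma> \<in> carrier (sym_group (dim_row A)).
        \<Prod>i = 1..dim_row A. A $$ (i - 1, \<sigma> i - 1))"

text \<open>
  Inequalities between complex numbers are those of Complex-Order:
  \<open>z \<le> w\<close> means \<open>Re z \<le> Re w\<close> and \<open>Im z = Im w\<close>.
  For Hermitian \<open>A\<close> the permanent is real, so
  \<open>normalized_gen_matrix_function G \<chi> A \<le> permanent A\<close> also asserts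
  that the left-hand side is real.
\<close>

text \<open>The next two definitions are meaningful only for \<open>n > 3\<close>.\<close>

definition M_const :: "nat \<Rightarrow> real" where
  "M_const n =
    (if even n then
       real n ^ n - (real n - 1) ^ n - fact n
         - real n ^ ((n - 4) div 2) * ((real n - 2) / 2) ^ ((n + 2) div 2) * ((real n + 4) / 2) - 1
     else
       real n ^ n - (real n - 1) ^ n - fact n
         - real n ^ ((n - 5) div 2) * ((real n - 1) / 2) ^ ((n + 1) div 2) * ((real n + 3) / 2) - 1)"

text \<open>
  If the first column of \<open>L\<close> vanishes, the quotient is \<open>0 / 0 = 0\<close> and
  the value is 0.
\<close>

definition eps_bound :: "nat \<Rightarrow> complex mat \<Rightarrow> real" where
  "eps_bound n L =
    (let \<alpha> = (\<Prod>i < n. cmod (L $$ (i, 0)));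
         \<alpha>\<^sub>0 = Max ((\<lambda>i. cmod (L $$ (i, 0))) ` {..<n})
     in min (\<alpha> / \<alpha>\<^sub>0 ^ (n - 1) * sqrt (2 / (3 * fact n * M_const n))) 1)"

end

theory Submission
  imports
    Defs
    "HOL-Algebra.Multiplicative_Group"
    "HOL-Analysis.L2_Norm"
begin

text \<open>
  Put \<open>c = \<chi> / \<chi>(e)\<close>. Roots of unity as eigenvalues give \<open>|c| \<le> 1\<close> and
  \<open>c(g\<^sup>-\<^sup>1) = cnj (c(g))\<close>, and irreducibility gives that \<open>c\<close> is constant 1 or sums to 0.
  For \<open>n > 3\<close> each product \<open>\<Prod>i. A i (g i)\<close> differs from \<open>\<alpha>\<^sup>2\<close> by at most \<open>\<alpha>\<^sup>2/4\<close>;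
  since the real part of the sum of \<open>c\<close> is at most \<open>n!/2\<close> unless \<open>G = S\<^sub>n\<close> and \<open>c = 1\<close>, the
  constant contributions \<open>\<alpha>\<^sup>2\<close> decide the inequality. For \<open>n = 3\<close> one compares the terms of the
  transpositions with those of the 3-cycles, which needs \<open>det A \<ge> 0\<close> only when \<open>c\<close> is a
  nontrivial character of the alternating group.
\<close>

section \<open>Normalized irreducible characters\<close>

lemma mat_trace_mult_comm:
  fixes A B :: "'a :: comm_semiring_0 mat"
  assumes "A \<in> carrier_mat n m" "B \<in> carrier_mat m n"
  shows "mat_trace (A * B) = mat_trace (B * A)"
proof -
  have "mat_trace (A * B) = (\<Sum>i<n. \<Sum>j<m. A $$ (i, j) * B $$ (j, i))"
    using assms by (auto simp: mat_trace_def scalar_prod_def atLeast0LessThan)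
  also have "\<dots> = (\<Sum>j<m. \<Sum>i<n. B $$ (j, i) * A $$ (i, j))"
    by (subst sum.swap) (simp add: mult.commute)
  also have "\<dots> = mat_trace (B * A)"
    using assms by (auto simp: mat_trace_def scalar_prod_def atLeast0LessThan)
  finally show ?thesis .
qed

lemma mat_trace_similar:
  fixes A B :: "'a :: comm_semiring_1 mat"
  assumes "similar_mat_wit A B P Q"
  shows "mat_trace A = mat_trace B"
proof -
  define n where "n = dim_row A"
  from similar_mat_witD[OF refl assms, folded n_def]
  have carr: "A \<in> carrier_mat n n" "B \<in> carrier_mat n n" "P \<in> carrier_mat n n" "Q \<in> carrier_mat n n"
    and QP: "Q * P = 1\<^sub>m n" and AB: "A = P * B * Q" by auto
  have "mat_trace A = mat_trace (Q * (P * B))"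
    unfolding AB using carr by (intro mat_trace_mult_comm) auto
  also have "Q * (P * B) = Q * P * B"
    using carr by (intro assoc_mult_mat[symmetric]) auto
  finally show ?thesis using QP carr by simp
qed

text \<open>In the product with one more factor, the summand with middle index \<open>j\<close> of
  entry \<open>(i, l)\<close> vanishes unless i \<le> j \<le> l. Nothing survives below the
  diagonal, and only \<open>j = i\<close> survives on it.\<close>

lemma upper_triangular_pow:
  fixes B :: "'a :: comm_semiring_1 mat"
  assumes "B \<in> carrier_mat m m" "upper_triangular B"
  shows "upper_triangular (B ^\<^sub>m k) \<and> (\<forall>i<m. (B ^\<^sub>m k) $$ (i, i) = (B $$ (i, i)) ^ k)"
proof (induction k)
  case 0
  then show ?case using assms by auto
next
  case (Suc k)
  define C where "C = B ^\<^sub>m k"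
  have C: "C \<in> carrier_mat m m" using assms by (auto simp: C_def)
  have CB: "C $$ (i, j) * B $$ (j, l) = 0" if "i < m" "j < m" "j < i \<or> l < j" for i j l
    using that Suc.IH assms C by (auto simp: C_def[symmetric] upper_triangular_def)
  have entry: "(C * B) $$ (i, l) = (\<Sum>j<m. C $$ (i, j) * B $$ (j, l))" if "i < m" "l < m" for i l
    using that C assms by (simp add: scalar_prod_def atLeast0LessThan)
  have "upper_triangular (C * B)"
  proof (rule upper_triangularI)
    fix i l assume "l < i" "i < dim_row (C * B)"
    then have il: "l < i" "i < m" "l < m" using C by auto
    show "(C * B) $$ (i, l) = 0"
      unfolding entry[OF il(2,3)] using CB il
      by (intro sum.neutral) (metis lessThan_iff linorder_less_linear order_less_trans)
  qed
  moreover have "(C * B) $$ (i, i) = B $$ (i, i) ^ Suc k" if "i < m" for i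
  proof -
    have "(C * B) $$ (i, i) = (\<Sum>j<m. if j = i then C $$ (i, i) * B $$ (i, i) else 0)"
      unfolding entry[OF that that] using CB that
      by (intro sum.cong) (auto simp: nat_neq_iff)
    then show ?thesis using that Suc.IH by (simp add: C_def mult.commute)
  qed
  ultimately show ?case by (simp add: C_def)
qed

text \<open>The \<open>e i\<close> are the diagonal entries of a Schur triangular form. One family
  serves all exponents at once, so the traces at a group element and at its inverse can be compared;
  finite order makes the \<open>e i\<close> roots of unity.\<close>

lemma mat_trace_pow:
  fixes A :: "complex mat"
  assumes A: "A \<in> carrier_mat m m"
  obtains e where "\<And>k. mat_trace (A ^\<^sub>m k) = (\<Sum>i<m. e i ^ k)"
    and "\<And>N i. A ^\<^sub>m N = 1\<^sub>m m \<Longrightarrow> i < m \<Longrightarrow> e i ^ N = 1"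
proof -
  obtain es where "char_poly A = (\<Prod>a \<leftarrow> es. [:- a, 1:])"
    using char_poly_factorized[OF A] by blast
  then obtain B where B: "B \<in> carrier_mat m m" "upper_triangular B" "similar_mat A B"
    using schur_decomposition_exists[OF A] by blast
  then obtain P Q where wit: "similar_mat_wit A B P Q"
    unfolding similar_mat_def by blast
  have dimA: "m = dim_row A" using A by simp
  have carr: "P \<in> carrier_mat m m" "Q \<in> carrier_mat m m"
    and QP: "Q * P = 1\<^sub>m m" and PQ: "P * Q = 1\<^sub>m m"
    using similar_mat_witD[OF dimA wit] by auto
  show thesis
  proof
    fix k
    have "mat_trace (A ^\<^sub>m k) = mat_trace (B ^\<^sub>m k)"
      by (rule mat_trace_similar[OF similar_mat_wit_pow[OF wit]])
    then show "mat_trace (A ^\<^sub>m k) = (\<Sum>i<m. (B $$ (i, i)) ^ k)"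
      using B upper_triangular_pow[OF B(1,2)] by (simp add: mat_trace_def)
  next
    fix N i assume AN: "A ^\<^sub>m N = 1\<^sub>m m" and i: "i < m"
    have "similar_mat_wit (B ^\<^sub>m N) (A ^\<^sub>m N) Q P"
      using similar_mat_wit_pow[OF wit] by (rule similar_mat_wit_sym)
    then have "B ^\<^sub>m N = Q * A ^\<^sub>m N * P"
      using B by (auto simp: similar_mat_wit_def Let_def)
    then have "B ^\<^sub>m N = 1\<^sub>m m"
      using carr QP AN by simp
    then show "(B $$ (i, i)) ^ N = 1"
      using i upper_triangular_pow[OF B(1,2)] by (metis index_one_mat(1))
  qed
qed

section \<open>Values of irreducible characters of a finite group\<close>

context group
begin

lemma representation_hom:
  assumes "representation G m \<rho>"
  shows "group_hom G (units_of (ring_mat TYPE(complex) m ())) \<rho>"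
proof -
  interpret R: ring "ring_mat TYPE(complex) m ()" by (rule ring_mat)
  show ?thesis
    using assms R.units_group is_group
    by (simp add: group_hom_def group_hom_axioms_def representation_def)
qed

lemma representation_carrier:
  assumes "representation G m \<rho>" "x \<in> carrier G"
  shows "\<rho> x \<in> carrier_mat m m"
  using group_hom.hom_closed[OF representation_hom[OF assms(1)] assms(2)]
  by (auto simp: units_of_def Units_def ring_mat_simps)

lemma representation_one:
  assumes "representation G m \<rho>"
  shows "\<rho> \<one> = 1\<^sub>m m"
  using group_hom.hom_one[OF representation_hom[OF assms]]
  by (simp add: units_of_one ring_mat_simps)

lemma representation_mult:
  assumes "representation G m \<rho>" "x \<in> carrier G" "y \<in> carrier G"
  shows "\<rho> (x \<otimes> y) = \<rho> x * \<rho> y"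
  using group_hom.hom_mult[OF representation_hom[OF assms(1)] assms(2,3)]
  by (simp add: units_of_mult ring_mat_simps)

lemma representation_pow:
  assumes "representation G m \<rho>" "x \<in> carrier G"
  shows "\<rho> (x [^] (k :: nat)) = \<rho> x ^\<^sub>m k"
proof (induction k)
  case 0
  then show ?case
    using representation_one[OF assms(1)] representation_carrier[OF assms] by simp
next
  case (Suc k)
  then show ?case using assms by (simp add: representation_mult)
qed

lemma irreducible_characterE:
  assumes "irreducible_character G \<chi>"
  obtains m \<rho> where "irreducible_representation G m \<rho>" "representation G m \<rho>" "0 < m"
    "\<And>g. g \<in> carrier G \<Longrightarrow> \<chi> g = mat_trace (\<rho> g)" "\<chi> \<one> = of_nat m"
proof -
  obtain m \<rho> where *: "irreducible_representation G m \<rho>"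
    "\<And>g. g \<in> carrier G \<Longrightarrow> \<chi> g = mat_trace (\<rho> g)"
    using assms unfolding irreducible_character_def by blast
  moreover have "representation G m \<rho>" "0 < m"
    using *(1) by (auto simp: irreducible_representation_def)
  moreover have "\<chi> \<one> = of_nat m"
    using *(2)[of \<one>] representation_one[OF \<open>representation G m \<rho>\<close>] by (simp add: mat_trace_def)
  ultimately show thesis using that by blast
qed

text \<open>Turns character values on a cyclic subgroup into power sums of roots of unity, so that
  the estimates that follow need no matrices.\<close>

lemma irreducible_character_eigenvalues:
  assumes "irreducible_character G \<chi>" "x \<in> carrier G" "x [^] (N :: nat) = \<one>"
  obtains m e where "0 < m" "\<chi> \<one> = of_nat m" "\<And>i. i < m \<Longrightarrow> e i ^ N = 1"
    "\<And>k :: nat. \<chi> (x [^] k) = (\<Sum>i<m. e i ^ k)"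
proof -
  obtain m \<rho> where \<rho>: "representation G m \<rho>" "0 < m"
    "\<And>g. g \<in> carrier G \<Longrightarrow> \<chi> g = mat_trace (\<rho> g)" "\<chi> \<one> = of_nat m"
    using irreducible_characterE[OF assms(1)] by metis
  obtain e where e: "\<And>k. mat_trace (\<rho> x ^\<^sub>m k) = (\<Sum>i<m. e i ^ k)"
    "\<And>N i. \<rho> x ^\<^sub>m N = 1\<^sub>m m \<Longrightarrow> i < m \<Longrightarrow> e i ^ N = 1"
    using mat_trace_pow[OF representation_carrier[OF \<rho>(1) assms(2)]] by blast
  have "\<rho> x ^\<^sub>m N = 1\<^sub>m m"
    using representation_pow[OF \<rho>(1) assms(2), of N] representation_one[OF \<rho>(1)] assms(3) by simp
  moreover have "\<chi> (x [^] k) = (\<Sum>i<m. e i ^ k)" for k :: nat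
    using \<rho>(3)[of "x [^] k"] representation_pow[OF \<rho>(1) assms(2), of k] e(1) assms(2) by simp
  ultimately show thesis using that \<rho> e(2) by blast
qed

lemma normalized_character_norm_le:
  assumes "irreducible_character G \<chi>" "finite (carrier G)" "x \<in> carrier G"
  shows "cmod (\<chi> x / \<chi> \<one>) \<le> 1"
proof -
  obtain m e where e: "0 < m" "\<chi> \<one> = of_nat m" "\<And>i. i < m \<Longrightarrow> e i ^ Coset.order G = 1"
    "\<And>k :: nat. \<chi> (x [^] k) = (\<Sum>i<m. e i ^ k)"
    using irreducible_character_eigenvalues[OF assms(1,3) pow_order_eq_1[OF assms(3)]] by blast
  have "Coset.order G > 0" using assms(2) order_gt_0_iff_finite by simp
  then have "cmod (e i) = 1" if "i < m" for i
    using arg_cong[OF e(3)[OF that], of cmod]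
      power_eq_imp_eq_base[of "cmod (e i)" "Coset.order G" 1] by (simp add: norm_power)
  then have "cmod (\<Sum>i<m. e i) \<le> m"
    using sum_norm_le[of "{..<m}" e "\<lambda>_. 1"] by simp
  then show ?thesis using e(1,2) e(4)[of 1] assms(3) by (simp add: norm_divide)
qed

lemma normalized_character_inv:
  assumes "irreducible_character G \<chi>" "finite (carrier G)" "x \<in> carrier G"
  shows "\<chi> (inv x) / \<chi> \<one> = cnj (\<chi> x / \<chi> \<one>)"
proof -
  obtain m e where e: "0 < m" "\<chi> \<one> = of_nat m" "\<And>i. i < m \<Longrightarrow> e i ^ Coset.order G = 1"
    "\<And>k :: nat. \<chi> (x [^] k) = (\<Sum>i<m. e i ^ k)"
    using irreducible_character_eigenvalues[OF assms(1,3) pow_order_eq_1[OF assms(3)]] by blast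
  have "Coset.order G > 0" using assms(2) order_gt_0_iff_finite by simp
  then obtain k where k: "Coset.order G = Suc k" using gr0_implies_Suc by blast
  have "x [^] k \<otimes> x = \<one>" using pow_order_eq_1[OF assms(3)] k by simp
  \<comment> \<open>As a power of \<open>x\<close>, the inverse has its character value expressed
    through the same eigenvalues; on the unit circle this power is the complex conjugate.\<close>
  then have inv: "inv x = x [^] k" using assms(3) by (simp add: inv_equality)
  have "e i ^ k = cnj (e i)" if "i < m" for i
  proof -
    have 1: "e i ^ k * e i = 1" using e(3)[OF that] k by (simp add: mult.commute)
    have "cmod (e i) ^ Suc k = 1" using e(3)[OF that] k by (metis norm_one norm_power)
    then have "cmod (e i) = 1" using power_eq_imp_eq_base[of "cmod (e i)" "Suc k" 1] by simp
    then have 2: "cnj (e i) * e i = 1"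
      using complex_norm_square[of "e i"] by (simp add: mult.commute)
    have "e i \<noteq> 0" using 1 by auto
    then show ?thesis using 1 2 by (metis mult_right_cancel)
  qed
  then have "\<chi> (inv x) = cnj (\<chi> x)"
    using e(4)[of k] e(4)[of 1] assms(3) inv by simp
  then show ?thesis using e(2) by simp
qed

lemma irreducible_character_commute:
  assumes "irreducible_character G \<chi>" "x \<in> carrier G" "y \<in> carrier G"
  shows "\<chi> (x \<otimes> y) = \<chi> (y \<otimes> x)"
proof -
  obtain m \<rho> where \<rho>: "representation G m \<rho>"
    "\<And>g. g \<in> carrier G \<Longrightarrow> \<chi> g = mat_trace (\<rho> g)"
    using irreducible_characterE[OF assms(1)] by metis
  then show ?thesis
    using assms mat_trace_mult_comm[OF representation_carrier[OF \<rho>(1)] representation_carrier[OF \<rho>(1)]]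
    by (simp add: representation_mult)
qed

text \<open>A cube root of unity has real part 1 or -1/2, and the normalized value is an average of
  such roots.\<close>

lemma normalized_character_order_3:
  assumes "irreducible_character G \<chi>" "x \<in> carrier G" "x [^] (3 :: nat) = \<one>"
  shows "Re (\<chi> x / \<chi> \<one>) \<ge> - 1 / 2"
proof -
  obtain m e where e: "0 < m" "\<chi> \<one> = of_nat m" "\<And>i. i < m \<Longrightarrow> e i ^ 3 = 1"
    "\<And>k :: nat. \<chi> (x [^] k) = (\<Sum>i<m. e i ^ k)"
    using irreducible_character_eigenvalues[OF assms] by blast
  have "Re (e i) \<ge> - 1 / 2" if "i < m" for i
  proof -
    have "(e i - 1) * (e i ^ 2 + e i + 1) = 0"
      using e(3)[OF that] by (simp add: algebra_simps power2_eq_square power3_eq_cube)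
    then consider "e i = 1" | "e i ^ 2 + e i + 1 = 0" by auto
    then show ?thesis
    proof cases
      case 2
      define a b where "a = Re (e i)" "b = Im (e i)"
      have "a\<^sup>2 - b\<^sup>2 + a + 1 = 0" "2 * a * b + b = 0"
        using arg_cong[OF 2, of Re] arg_cong[OF 2, of Im]
        by (simp_all add: a_b_def power2_eq_square algebra_simps)
      moreover from this(2) have "b * (2 * a + 1) = 0" by (simp add: algebra_simps)
      then have "b = 0 \<or> a = - 1 / 2" by auto
      \<comment> \<open>Rules out \<open>b = 0\<close>: the quadratic factor has no real
        root.\<close>
      moreover have "a\<^sup>2 + a + 1 > 0" 
        using zero_le_power2[of "a + 1/2"] by (simp add: power2_eq_square algebra_simps)
      ultimately show ?thesis by (auto simp: a_b_def)
    qed auto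
  qed
  then have "(\<Sum>i<m. Re (e i)) \<ge> (\<Sum>i<m. - 1 / 2)" by (intro sum_mono) auto
  then show ?thesis using e(1,2) e(4)[of 1] assms(2) by (simp add: field_simps)
qed

text \<open>By irreducibility, the fixed vectors form either the zero space, which contains the
  columns of the sum of all group elements, or the whole space.\<close>

lemma irreducible_character_trivial_or_sum_0:
  assumes "irreducible_character G \<chi>" "finite (carrier G)"
  shows "(\<forall>x \<in> carrier G. \<chi> x = \<chi> \<one>) \<or> (\<Sum>x \<in> carrier G. \<chi> x) = 0"
proof -
  obtain m \<rho> where irr: "irreducible_representation G m \<rho>" and \<rho>: "representation G m \<rho>" "0 < m"
    "\<And>g. g \<in> carrier G \<Longrightarrow> \<chi> g = mat_trace (\<rho> g)" "\<chi> \<one> = of_nat m"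
    using irreducible_characterE[OF assms(1)] by metis
  note carr = representation_carrier[OF \<rho>(1)]
  define W where "W = {v \<in> carrier_vec m. \<forall>g \<in> carrier G. \<rho> g *\<^sub>v v = v}"
  have zero: "\<rho> g *\<^sub>v 0\<^sub>v m = 0\<^sub>v m" if "g \<in> carrier G" for g
    using carr[OF that] by (intro eq_vecI) (auto simp: scalar_prod_def)
  have "submodule class_ring W (module_vec TYPE(complex) m)"
    unfolding submodule_def using carr
    by (auto simp: W_def module_vec_simps vec_module
        mult_add_distrib_mat_vec[of _ m m] mult_mat_vec[of _ m m] zero)
  then have "invariant_subspace G m \<rho> W"
    by (auto simp: invariant_subspace_def W_def intro: VectorSpace.subspace.intro[OF vec_vs])
  then consider "W = {0\<^sub>v m}" | "W = carrier_vec m"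
    using irr unfolding irreducible_representation_def by blast
  then show ?thesis
  proof cases
    case 1
    define S where "S = (\<lambda>i j. \<Sum>g \<in> carrier G. \<rho> g $$ (i, j))"
    have "S i j = 0" if "i < m" "j < m" for i j
    proof -
      define v where "v = vec m (\<lambda>i. S i j)"
      have "\<rho> h *\<^sub>v v = v" if h: "h \<in> carrier G" for h
      proof (rule eq_vecI)
        fix i assume i: "i < dim_vec v"
        have "(\<rho> h *\<^sub>v v) $ i = (\<Sum>k<m. \<rho> h $$ (i, k) * S k j)"
          using i carr[OF h] by (simp add: v_def scalar_prod_def atLeast0LessThan)
        also have "\<dots> = (\<Sum>g \<in> carrier G. \<Sum>k<m. \<rho> h $$ (i, k) * \<rho> g $$ (k, j))"
          unfolding S_def sum_distrib_left by (rule sum.swap)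
        also have "\<dots> = (\<Sum>g \<in> carrier G. (\<rho> (h \<otimes> g)) $$ (i, j))"
          using i carr h \<open>j < m\<close>
          by (intro sum.cong) (simp_all add: representation_mult[OF \<rho>(1)] v_def scalar_prod_def
              atLeast0LessThan carrier_matD[OF carr])
        \<comment> \<open>Left translation by \<open>h\<close> permutes the group, so
          \<open>h\<close> fixes every column of \<open>S\<close>.\<close>
        also have "\<dots> = S i j"
          unfolding S_def using h
          by (intro sum.reindex_bij_witness[of _ "\<lambda>g. inv h \<otimes> g" "\<lambda>g. h \<otimes> g"])
            (auto simp: m_assoc[symmetric])
        finally show "(\<rho> h *\<^sub>v v) $ i = v $ i" using i by (simp add: v_def)
      qed (use carr[OF h] in \<open>simp add: v_def\<close>)
      then have "v \<in> W" by (simp add: W_def v_def)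
      then have "v $ i = 0" using 1 that by simp
      then show ?thesis using that by (simp add: v_def)
    qed
    moreover have "(\<Sum>x \<in> carrier G. \<chi> x) = (\<Sum>x \<in> carrier G. \<Sum>i<m. \<rho> x $$ (i, i))"
      using carr by (intro sum.cong) (simp_all add: \<rho>(3) mat_trace_def carrier_matD[OF carr])
    then have "(\<Sum>x \<in> carrier G. \<chi> x) = (\<Sum>i<m. S i i)"
      by (simp add: S_def sum.swap[of _ "{..<m}"])
    ultimately show ?thesis by simp
  next
    case 2
    \<comment> \<open>All unit vectors are fixed, so \<open>\<rho> g\<close> has ones on its
      diagonal and its trace is the degree.\<close>
    have "\<chi> g = \<chi> \<one>" if g: "g \<in> carrier G" for g
    proof -
      have "\<rho> g $$ (i, i) = 1" if "i < m" for i
      proof -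
        have "\<rho> g *\<^sub>v unit_vec m i = unit_vec m i"
          using 2 g by (auto simp: W_def)
        then have "(\<rho> g *\<^sub>v unit_vec m i) $ i = 1" using that by simp
        then show ?thesis using carr[OF g] that by simp
      qed
      then show ?thesis using \<rho>(3)[OF g] \<rho>(4) carr[OF g] by (simp add: mat_trace_def)
    qed
    then show ?thesis by blast
  qed
qed

end

section \<open>Normalized characters of permutation groups\<close>

text \<open>\<open>c\<close> stands for a normalized character \<open>\<chi> / \<chi>(e)\<close>.\<close>

locale perm_group_character =
  fixes n :: nat and G :: "(nat \<Rightarrow> nat) set" and c :: "(nat \<Rightarrow> nat) \<Rightarrow> complex"
  assumes permutes: "g \<in> G \<Longrightarrow> g permutes {1..n}"
    and id_mem: "id \<in> G"
    and comp_mem: "g \<in> G \<Longrightarrow> h \<in> G \<Longrightarrow> g \<circ> h \<in> G"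
    and inv_mem: "g \<in> G \<Longrightarrow> inv' g \<in> G"
    and c_id: "c id = 1"
    and norm_c_le: "g \<in> G \<Longrightarrow> cmod (c g) \<le> 1"
    and c_inv: "g \<in> G \<Longrightarrow> c (inv' g) = cnj (c g)"
    and c_commute: "g \<in> G \<Longrightarrow> h \<in> G \<Longrightarrow> c (g \<circ> h) = c (h \<circ> g)"
    and trivial_or_sum_0: "(\<forall>g \<in> G. c g = 1) \<or> (\<Sum>g \<in> G. c g) = 0"
    and order_3: "g \<in> G \<Longrightarrow> g \<circ> g \<circ> g = id \<Longrightarrow> Re (c g) \<ge> - 1 / 2"
begin

text \<open>The sum equals its own conjugate: conjugation transposes \<open>B\<close>, reindexing
  each product by \<open>g\<close> replaces \<open>g\<close> by its inverse, and
  \<open>c_inv\<close> together with inversion on \<open>G\<close> restores the original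
  sum.\<close>

lemma Im_hermitian_sum:
  assumes "\<And>i j. i \<in> {1..n} \<Longrightarrow> j \<in> {1..n} \<Longrightarrow> B j i = cnj (B i j)"
  shows "Im (\<Sum>g \<in> G. c g * (\<Prod>i = 1..n. B i (g i))) = 0"
proof -
  define S where "S = (\<Sum>g \<in> G. c g * (\<Prod>i = 1..n. B i (g i)))"
  have inv_inv: "inv' (inv' g) = g" if "g \<in> G" for g
    using permutes[OF that] by (simp add: permutes_inv_inv)
  have "cnj S = (\<Sum>g \<in> G. c (inv' g) * (\<Prod>i = 1..n. B (g i) i))"
  proof -
    have "cnj (B i (g i)) = B (g i) i" if "g \<in> G" "i \<in> {1..n}" for g i
      using assms[of i "g i"] permutes_in_image[OF permutes[OF that(1)], of i] that(2) by simp
    then show ?thesis unfolding S_def by (simp add: c_inv)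
  qed
  also have "\<dots> = (\<Sum>g \<in> G. c (inv' g) * (\<Prod>i = 1..n. B i (inv' g i)))"
  proof (intro sum.cong refl arg_cong2[of _ _ _ _ "(*)"])
    fix g assume "g \<in> G"
    note g = permutes[OF this]
    have "(\<Prod>i = 1..n. B i (inv' g i)) = (\<Prod>i = 1..n. B (g i) (inv' g (g i)))"
      using prod.permute[OF g, of "\<lambda>i. B i (inv' g i)"] by (simp add: comp_def)
    then show "(\<Prod>i = 1..n. B (g i) i) = (\<Prod>i = 1..n. B i (inv' g i))"
      by (simp add: permutes_inverses(2)[OF g])
  qed
  also have "\<dots> = S"
    unfolding S_def using inv_mem inv_inv
    by (intro sum.reindex_bij_witness[of _ inv' inv']) auto
  finally have "Im S = 0" by (simp add: complex_eq_iff)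
  then show ?thesis unfolding S_def .
qed

end

lemma irreducible_character_perm_group:
  assumes G: "subgroup G (sym_group n)"
    and \<chi>: "irreducible_character (sym_group n \<lparr>carrier := G\<rparr>) \<chi>"
  shows "perm_group_character n G (\<lambda>g. \<chi> g / \<chi> id)"
proof -
  define H where "H = sym_group n \<lparr>carrier := G\<rparr>"
  interpret S: group "sym_group n" by (rule sym_group_is_group)
  interpret H: group H unfolding H_def using S.subgroup_imp_group[OF G] .
  have H_simps: "carrier H = G" "one H = id" "mult H = (\<circ>)"
    by (simp_all add: H_def sym_group_one sym_group_mult)
  note \<chi> = \<chi>[folded H_def]
  have perm: "g permutes {1..n}" if "g \<in> G" for g
    using subgroup.mem_carrier[OF G that] by (simp add: sym_group_carrier)
  have fin: "finite (carrier H)"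
    using finite_subset[of G "{g. g permutes {1..n}}"] perm
    by (auto simp: H_simps finite_permutations)
  have inv: "inv\<^bsub>H\<^esub> g = inv' g" if "g \<in> G" for g
  proof -
    have "inv\<^bsub>H\<^esub> g \<circ> g = id" using H.l_inv[of g] that by (simp add: H_simps)
    then have "inv\<^bsub>H\<^esub> g \<circ> g \<circ> inv' g = inv' g" by simp
    then show ?thesis using permutes_inv_o(1)[OF perm[OF that]] by (simp add: comp_assoc)
  qed
  obtain m where "0 < m" "\<chi> id = of_nat m"
    using H.irreducible_characterE[OF \<chi>] by (metis H_simps(2))
  then have nz: "\<chi> id \<noteq> 0" by simp
  show ?thesis
  proof
    show "inv' g \<in> G" if "g \<in> G" for g using H.inv_closed[of g] inv[OF that] that H_simps by simp
    show "\<chi> (inv' g) / \<chi> id = cnj (\<chi> g / \<chi> id)" if "g \<in> G" for g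
      using H.normalized_character_inv[OF \<chi> fin, of g] inv[OF that] that by (simp add: H_simps)
    show "cmod (\<chi> g / \<chi> id) \<le> 1" if "g \<in> G" for g
      using H.normalized_character_norm_le[OF \<chi> fin, of g] that by (simp add: H_simps)
    show "\<chi> (g \<circ> h) / \<chi> id = \<chi> (h \<circ> g) / \<chi> id" if "g \<in> G" "h \<in> G" for g h
      using H.irreducible_character_commute[OF \<chi>, of g h] that by (simp add: H_simps)
    show "(\<forall>g\<in>G. \<chi> g / \<chi> id = 1) \<or> (\<Sum>g\<in>G. \<chi> g / \<chi> id) = 0"
      using H.irreducible_character_trivial_or_sum_0[OF \<chi> fin] nz
      by (auto simp: H_simps simp flip: sum_divide_distrib)
    show "- 1 / 2 \<le> Re (\<chi> g / \<chi> id)" if "g \<in> G" "g \<circ> g \<circ> g = id" for g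
      using H.normalized_character_order_3[OF \<chi>, of g] that
      by (simp add: H_simps eval_nat_numeral)
  qed (use perm nz H.one_closed H.m_closed in \<open>auto simp: H_simps\<close>)
qed

section \<open>Matrices of size at least four\<close>

lemma fact_le_mult_power:
  assumes "3 \<le> n"
  shows "(fact n :: real) \<le> (real n - 1) * real n ^ (n - 2)"
  using assms
proof (induction n rule: dec_induct)
  case base
  then show ?case by (simp add: eval_nat_numeral)
next
  case (step k)
  have "(fact (Suc k) :: real) \<le> real (Suc k) * ((real k - 1) * real k ^ (k - 2))"
    using step.IH by (simp add: mult_left_mono)
  also have "\<dots> = (real k - 1) * (real (Suc k) * real k ^ (k - 2))" by simp
  also have "\<dots> \<le> real k * (real (Suc k) * real (Suc k) ^ (k - 2))"
    using step.hyps by (intro mult_mono mult_left_mono power_mono) simp_all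
  also have "real (Suc k) * real (Suc k) ^ (k - 2) = real (Suc k) ^ (Suc k - 2)"
    using step.hyps by (simp only: power_Suc[symmetric] Suc_diff_le)
  finally show ?case by simp
qed

text \<open>In units of \<open>y\<close>, the three leading terms are controlled by x^2, (x-1)^2 and
  x-1, and the mixed product by x/2. What remains is xy/2 - 1, which is at least 31. The value 3 is
  chosen for \<open>eps_bound_properties\<close>, where 8/3 is the threshold.\<close>

lemma M_const_ge_3:
  assumes "3 < n"
  shows "3 \<le> M_const n"
proof -
  define x where "x = real n"
  define y where "y = x ^ (n - 2)"
  have x: "x \<ge> 4" using assms by (simp add: x_def)
  have n: "n = Suc (Suc (n - 2))" using assms by simp
  have xy: "x ^ n = x * x * y" "x ^ (n - 1) = x * y"
    using n unfolding y_def by (metis power_Suc mult.assoc, metis power_Suc diff_Suc_1)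
  have "(x - 1) ^ n = (x - 1) * (x - 1) * (x - 1) ^ (n - 2)"
    using n by (metis power_Suc mult.assoc)
  also have "\<dots> \<le> (x - 1) * (x - 1) * y"
    unfolding y_def using x by (intro mult_left_mono power_mono) auto
  finally have diff: "(x - 1) ^ n \<le> (x - 1) * (x - 1) * y" .
  have fact: "(fact n :: real) \<le> (x - 1) * y"
    using fact_le_mult_power[of n] assms by (simp add: x_def y_def)
  have "(4 :: real) ^ 2 \<le> x ^ 2" using x by (intro power_mono) auto
  also have "x ^ 2 \<le> y" unfolding y_def using x assms by (intro power_increasing) auto
  finally have y: "y \<ge> 16" by simp
  have pow2: "real m + 2 \<le> 2 ^ m" if "2 \<le> m" for m :: nat
    using that by (induction m rule: dec_induct) auto
  \<comment> \<open>Serves both parities. The factor \<open>real m + 2\<close> is at most 2^m and so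
    cancels all but one of the \<open>m + 1\<close> halves.\<close>
  have half: "x ^ (m - 2) * z ^ (m + 1) * (real m + 2) \<le> x ^ (2 * m - 1) / 2"
    if m: "2 \<le> m" and z: "0 \<le> z" "z \<le> x / 2" for m z
  proof -
    have "x ^ (m - 2) * z ^ (m + 1) * (real m + 2) \<le> x ^ (m - 2) * (x / 2) ^ (m + 1) * 2 ^ m"
      using pow2[OF m] z x by (intro mult_mono power_mono) auto
    also have "\<dots> = x ^ (m - 2 + (m + 1)) / 2"
      by (simp add: power_divide power_add)
    also have "m - 2 + (m + 1) = 2 * m - 1" using m by simp
    finally show ?thesis .
  qed
  have "M_const n \<ge> x ^ n - (x - 1) ^ n - fact n - x * y / 2 - 1"
  proof (cases "even n")
    case True
    then obtain m where m: "n = 2 * m" by blast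
    then have m2: "2 \<le> m" using assms by simp
    \<comment> \<open>The numerators are even and m \<ge> 2, so neither \<open>div\<close> nor the
      subtraction truncates.\<close>
    have div: "(n - 4) div 2 = m - 2" "(n + 2) div 2 = m + 1" using m by auto
    have E: "(x + 4) / 2 = real m + 2" by (simp add: x_def m)
    have "x ^ (m - 2) * ((x - 2) / 2) ^ (m + 1) * (real m + 2) \<le> x ^ (2 * m - 1) / 2"
      using x m2 by (intro half) auto
    then show ?thesis
      using True xy(2) unfolding M_const_def div x_def[symmetric] E by (simp add: m)
  next
    case False
    then obtain m where m: "n = 2 * m + 1" using oddE by blast
    then have m2: "2 \<le> m" using assms by simp
    have div: "(n - 5) div 2 = m - 2" "(n + 1) div 2 = m + 1" using m by auto
    have E: "(x + 3) / 2 = real m + 2" by (simp add: x_def m)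
    have "x ^ (m - 2) * ((x - 1) / 2) ^ (m + 1) * (real m + 2) \<le> x ^ (2 * m - 1) / 2"
      using x m2 by (intro half) auto
    \<comment> \<open>For odd \<open>n\<close> the exponent is n-2 instead of n-1, so this case has
      a factor \<open>x\<close> to spare.\<close>
    also have "x ^ (2 * m - 1) = y" by (simp add: y_def m)
    also have "y / 2 \<le> x * y / 2" using x y by simp
    finally show ?thesis
      using False unfolding M_const_def div x_def[symmetric] E by simp
  qed
  moreover have "x * x * y - (x - 1) * (x - 1) * y - (x - 1) * y - x * y / 2 = x * y / 2"
    by (simp add: algebra_simps)
  moreover have "4 * 16 \<le> x * y" using x y by (intro mult_mono) auto
  ultimately show ?thesis using diff fact xy(1) by linarith
qed

text \<open>The definition is made for the last bound: squaring removes the root, the factorial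
  cancels, and M_n \<ge> 3 leaves the factor 2/9 < 1/4. The bound by \<open>a0\<close> makes
  \<open>a0\<close> a common bound for all entries of \<open>L\<close>.\<close>

lemma eps_bound_properties:
  fixes n L
  defines "a0 \<equiv> Max ((\<lambda>i. cmod (L $$ (i, 0))) ` {..<n})"
  assumes n: "3 < n"
  shows "\<And>i. i < n \<Longrightarrow> cmod (L $$ (i, 0)) \<le> a0"
    and "0 \<le> eps_bound n L" "eps_bound n L \<le> a0"
    and "fact n * (a0 ^ (n - 1) * eps_bound n L)\<^sup>2 \<le> (\<Prod>i<n. cmod (L $$ (i, 0)))\<^sup>2 / 4"
proof -
  define al where "al = (\<Prod>i<n. cmod (L $$ (i, 0)))"
  define s where "s = sqrt (2 / (3 * fact n * M_const n))"
  have e: "eps_bound n L = min (al / a0 ^ (n - 1) * s) 1"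
    by (simp add: eps_bound_def al_def a0_def s_def Let_def)
  show le: "cmod (L $$ (i, 0)) \<le> a0" if "i < n" for i
    unfolding a0_def using that by (intro Max_ge) auto
  have a0: "0 \<le> a0" using order_trans[OF norm_ge_zero le[of 0]] n by simp
  have al: "0 \<le> al" by (simp add: al_def prod_nonneg)
  have M: "3 \<le> M_const n" using M_const_ge_3[OF n] .
  have f1: "(1 :: real) \<le> fact n" by (rule fact_ge_1)
  have FM: "3 \<le> fact n * M_const n" using mult_mono[OF f1 M] f1 by simp
  have s0: "0 \<le> s" using M by (simp add: s_def)
  have s2: "s\<^sup>2 = 2 / (3 * fact n * M_const n)" using M by (simp add: s_def)
  have s1: "s \<le> 1" unfolding s_def using FM by (simp add: mult.assoc)
  show e0: "0 \<le> eps_bound n L" unfolding e using a0 al s0 by simp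
  have aln: "al \<le> a0 ^ n"
  proof -
    have "al \<le> (\<Prod>i<n. a0)" unfolding al_def using le by (intro prod_mono) auto
    then show ?thesis by simp
  qed
  have power_n: "a0 ^ n = a0 * a0 ^ (n - 1)" using n by (metis power_eq_if not_less_zero)
  show "eps_bound n L \<le> a0"
  proof (cases "a0 = 0")
    \<comment> \<open>Division by zero yields 0, so the entry bound is 0 too.\<close>
    case True
    then show ?thesis using n by (simp add: e power_0_left)
  next
    case False
    then have "al / a0 ^ (n - 1) \<le> a0" using a0 aln power_n by (simp add: field_simps)
    then have "al / a0 ^ (n - 1) * s \<le> a0 * 1" using a0 al s0 s1 by (intro mult_mono) auto
    then show ?thesis by (simp add: e)
  qed
  have "a0 ^ (n - 1) * eps_bound n L \<le> al * s"
  proof (cases "a0 = 0")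
    case True
    then show ?thesis using n al s0 by (simp add: power_0_left)
  next
    case False
    have "a0 ^ (n - 1) * eps_bound n L \<le> a0 ^ (n - 1) * (al / a0 ^ (n - 1) * s)"
      using a0 by (intro mult_left_mono) (auto simp: e)
    then show ?thesis using False by simp
  qed
  then have "(a0 ^ (n - 1) * eps_bound n L)\<^sup>2 \<le> (al * s)\<^sup>2"
    using a0 e0 by (intro power_mono) auto
  then have "fact n * (a0 ^ (n - 1) * eps_bound n L)\<^sup>2 \<le> fact n * (al * s)\<^sup>2"
    by (intro mult_left_mono) auto
  also have "\<dots> = al\<^sup>2 * (2 / (3 * M_const n))"
    unfolding power_mult_distrib s2 by (simp add: field_simps)
  also have "\<dots> \<le> al\<^sup>2 * (1 / 4)" using M by (intro mult_left_mono) (auto simp: field_simps)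
  finally show "fact n * (a0 ^ (n - 1) * eps_bound n L)\<^sup>2 \<le> (\<Prod>i<n. cmod (L $$ (i, 0)))\<^sup>2 / 4"
    by (simp add: al_def)
qed

section \<open>Approximation of products of Gram matrix entries\<close>

lemma prod_norm_le_power_mult:
  fixes w :: "'i \<Rightarrow> 'a :: real_normed_field"
  assumes "finite I" "j \<in> I" "norm (w j) \<le> e" "\<And>i. i \<in> I \<Longrightarrow> norm (w i) \<le> a"
  shows "norm (\<Prod>i\<in>I. w i) \<le> a ^ (card I - 1) * e"
proof -
  have "a \<ge> 0" by (rule order_trans[OF norm_ge_zero assms(4)[OF assms(2)]])
  have "norm (\<Prod>i\<in>I. w i) = (\<Prod>i\<in>I - {j}. norm (w i)) * norm (w j)"
    unfolding prod.remove[OF assms(1,2)] norm_mult prod_norm by (rule mult.commute)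
  also have "\<dots> \<le> (\<Prod>i\<in>I - {j}. a) * e"
  proof (rule mult_mono[OF prod_mono assms(3)])
    show "0 \<le> norm (w i) \<and> norm (w i) \<le> a" if "i \<in> I - {j}" for i
      using assms(4) that by simp
  qed (use \<open>a \<ge> 0\<close> in \<open>simp_all add: prod_nonneg\<close>)
  also have "(\<Prod>i\<in>I - {j}. a) = a ^ (card I - 1)"
    using assms(1,2) by simp
  finally show ?thesis .
qed

text \<open>Expand the product of the entries of the Gram matrix over all choices of a column in
  each row: the choice of the first column throughout gives the main term, and any other
  choice picks up a small entry in both products. Triangularity leaves only \<open>n!\<close> choices.\<close>

lemma gram_product_approx:
  fixes R :: "nat \<Rightarrow> nat \<Rightarrow> complex"
  assumes p: "p permutes {1..n}"
    and low: "\<And>i k. i \<in> {1..n} \<Longrightarrow> k < n \<Longrightarrow> i \<le> k \<Longrightarrow> R i k = 0"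
    and first: "\<And>i. i \<in> {1..n} \<Longrightarrow> cmod (R i 0) \<le> a"
    and others: "\<And>i k. i \<in> {1..n} \<Longrightarrow> k < n \<Longrightarrow> k \<noteq> 0 \<Longrightarrow> cmod (R i k) \<le> e"
    and "0 \<le> e" "e \<le> a"
  shows "cmod ((\<Prod>i = 1..n. \<Sum>k<n. R i k * cnj (R (p i) k)) - (\<Prod>i = 1..n. cmod (R i 0))\<^sup>2)
    \<le> fact n * (a ^ (n - 1) * e)\<^sup>2"
proof -
  \<comment> \<open>Rows count from 1 and columns from 0, so row \<open>i\<close> has exactly
    \<open>i\<close> columns on or left of the diagonal; this gives \<open>n!\<close>
    choices.\<close>
  define F where "F = Pi\<^sub>E {1..n} (\<lambda>i. {..<i})"
  define T where "T = (\<lambda>f. \<Prod>i = 1..n. R i (f i) * cnj (R (p i) (f i)))"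
  define f0 :: "nat \<Rightarrow> nat" where "f0 = restrict (\<lambda>_. 0) {1..n}"
  have F: "finite F" "f0 \<in> F" unfolding F_def f0_def by (auto intro: finite_PiE)
  have "card F = fact n" unfolding F_def by (simp add: card_PiE fact_prod)
  have "(\<Prod>i = 1..n. \<Sum>k<n. R i k * cnj (R (p i) k))
      = (\<Prod>i = 1..n. \<Sum>k<i. R i k * cnj (R (p i) k))"
    using low by (intro prod.cong sum.mono_neutral_right) auto
  also have "\<dots> = (\<Sum>f\<in>F. T f)"
    unfolding F_def T_def by (subst prod_sum_PiE) auto
  also have "\<dots> = T f0 + (\<Sum>f\<in>F - {f0}. T f)"
    using F by (rule sum.remove)
  finally have expand: "(\<Prod>i = 1..n. \<Sum>k<n. R i k * cnj (R (p i) k)) = \<dots>" .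
  have "T f0 = (\<Prod>i = 1..n. R i 0) * cnj (\<Prod>i = 1..n. R (p i) 0)"
    unfolding T_def f0_def by (simp add: prod.distrib)
  \<comment> \<open>Permuting the rows does not change the product of the first column, so the main
    term is the same for every \<open>p\<close>.\<close>
  also have "(\<Prod>i = 1..n. R (p i) 0) = (\<Prod>i = 1..n. R i 0)"
    using prod.permute[OF p, of "\<lambda>i. R i 0"] by (simp add: comp_def)
  finally have main: "T f0 = of_real ((\<Prod>i = 1..n. cmod (R i 0))\<^sup>2)"
    by (simp only: complex_norm_square[symmetric] prod_norm)
  have bound: "cmod (T f) \<le> (a ^ (n - 1) * e)\<^sup>2" if f: "f \<in> F - {f0}" for f
  proof -
    have fF: "f \<in> Pi\<^sub>E {1..n} (\<lambda>i. {..<i})" using f by (simp add: F_def)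
    \<comment> \<open>Members of \<open>F\<close> are extensional, so a choice other than
      \<open>f0\<close> differs from it inside \<open>{1..n}\<close>.\<close>
    have "\<exists>j\<in>{1..n}. f j \<noteq> 0"
    proof (rule ccontr)
      assume "\<not> ?thesis"
      then have "f = f0" using fF by (auto simp: f0_def fun_eq_iff PiE_def extensional_def)
      then show False using f by simp
    qed
    then obtain j where j: "j \<in> {1..n}" "f j \<noteq> 0" by blast
    have fn: "f i < n" if "i \<in> {1..n}" for i using PiE_mem[OF fF that] that by auto
    have pn: "p i \<in> {1..n}" if "i \<in> {1..n}" for i using that permutes_in_image[OF p] by blast
    have entry: "cmod (R i (f k)) \<le> a" if "i \<in> {1..n}" "k \<in> {1..n}" for i k
      using first[OF that(1)] others[OF that(1) fn[OF that(2)]] \<open>e \<le> a\<close> by (cases "f k = 0") auto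
    have 1: "cmod (\<Prod>i = 1..n. R i (f i)) \<le> a ^ (n - 1) * e"
      using prod_norm_le_power_mult[of "{1..n}" j "\<lambda>i. R i (f i)" e a]
        j entry others[OF j(1) fn[OF j(1)] j(2)] by simp
    have 2: "cmod (\<Prod>i = 1..n. R (p i) (f i)) \<le> a ^ (n - 1) * e"
      using prod_norm_le_power_mult[of "{1..n}" j "\<lambda>i. R (p i) (f i)" e a]
        j entry pn others[OF pn[OF j(1)] fn[OF j(1)] j(2)] by simp
    have "cmod (T f) = cmod (\<Prod>i = 1..n. R i (f i)) * cmod (\<Prod>i = 1..n. R (p i) (f i))"
      unfolding T_def prod.distrib norm_mult by (simp flip: cnj_prod)
    also have "\<dots> \<le> (a ^ (n - 1) * e) * (a ^ (n - 1) * e)"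
      using 1 2 by (intro mult_mono) (auto intro: order_trans[OF norm_ge_zero])
    finally show ?thesis by (simp add: power2_eq_square)
  qed
  have "cmod (\<Sum>f\<in>F - {f0}. T f) \<le> (\<Sum>f\<in>F - {f0}. (a ^ (n - 1) * e)\<^sup>2)"
    using bound by (rule sum_norm_le)
  also have "\<dots> \<le> (\<Sum>f\<in>F. (a ^ (n - 1) * e)\<^sup>2)"
    using F(1) by (intro sum_mono2) auto
  also have "\<dots> = fact n * (a ^ (n - 1) * e)\<^sup>2"
    using \<open>card F = fact n\<close> by simp
  finally show ?thesis unfolding expand main by simp
qed

section \<open>Comparison of sums with nearly constant terms\<close>

lemma perturbed_sum_le:
  fixes P :: "'g \<Rightarrow> complex"
  assumes S: "finite S" "G \<subseteq> S"
    and c: "\<And>g. g \<in> G \<Longrightarrow> cmod (c g) \<le> 1" "Re (\<Sum>g\<in>G. c g) \<le> card S / 2"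
    and P: "\<And>g. g \<in> S \<Longrightarrow> cmod (P g - of_real q) \<le> q / 4"
    and "0 \<le> q"
  shows "Re (\<Sum>g\<in>G. c g * P g) \<le> Re (\<Sum>g\<in>S. P g)"
proof -
  have "card G \<le> card S" using S by (rule card_mono)
  have "Re (\<Sum>g\<in>G. c g * P g) = q * Re (\<Sum>g\<in>G. c g) + Re (\<Sum>g\<in>G. c g * (P g - of_real q))"
    by (simp add: algebra_simps sum_subtractf sum_distrib_left)
  also have "Re (\<Sum>g\<in>G. c g * (P g - of_real q)) \<le> (\<Sum>g\<in>G. q / 4)"
  proof (rule order_trans[OF complex_Re_le_cmod sum_norm_le])
    fix g assume g: "g \<in> G"
    have "cmod (c g * (P g - of_real q)) \<le> 1 * (q / 4)"
      unfolding norm_mult using c(1)[OF g] P[of g] g S by (intro mult_mono) auto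
    then show "cmod (c g * (P g - of_real q)) \<le> q / 4" by simp
  qed
  also have "(\<Sum>g\<in>G. q / 4) \<le> q / 4 * card S"
    using \<open>card G \<le> card S\<close> \<open>0 \<le> q\<close> by (simp add: mult.commute mult_left_mono)
  \<comment> \<open>The tolerance q/4 is the balance point: 1/2 + 1/4 on the left meets 1 - 1/4 on
    the right.\<close>
  also have "q * Re (\<Sum>g\<in>G. c g) \<le> q * (card S / 2)"
    using c(2) \<open>0 \<le> q\<close> by (rule mult_left_mono)
  finally have "Re (\<Sum>g\<in>G. c g * P g) \<le> (\<Sum>g\<in>S. 3 / 4 * q)" by (simp add: mult_ac)
  also have "\<dots> \<le> (\<Sum>g\<in>S. Re (P g))"
  proof (rule sum_mono)
    fix g assume "g \<in> S"
    then show "3 / 4 * q \<le> Re (P g)"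
      using P[of g] abs_Re_le_cmod[of "P g - of_real q"] by simp
  qed
  finally show ?thesis by simp
qed

text \<open>The coset of \<open>t\<close> is disjoint from \<open>G\<close> and has the same
  size.\<close>

lemma (in perm_group_character) twice_card_le:
  assumes "t permutes {1..n}" "t \<notin> G"
  shows "2 * card G \<le> card {g. g permutes {1..n}}"
proof -
  have fin: "finite {g. g permutes {1..n}}" by (simp add: finite_permutations)
  have sub: "G \<subseteq> {g. g permutes {1..n}}" using permutes by auto
  have finG: "finite G" using finite_subset[OF sub fin] .
  have bij: "bij t" using permutes_bij[OF assms(1)] .
  have "inj_on ((\<circ>) t) G"
    using bij by (auto simp: inj_on_def fun.inj_map_strong bij_def fun_eq_iff dest: injD)
  then have "card ((\<circ>) t ` G) = card G" by (rule card_image)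
  moreover have "G \<inter> (\<circ>) t ` G = {}"
  proof -
    have "t \<in> G" if "t \<circ> g \<in> G" "g \<in> G" for g
    proof -
      have "(t \<circ> g) \<circ> inv' g = t"
        using permutes_inv_o(1)[OF permutes[OF that(2)]] by (simp add: comp_assoc)
      then show ?thesis using comp_mem[OF that(1) inv_mem[OF that(2)]] by simp
    qed
    then show ?thesis using assms(2) by auto
  qed
  ultimately have "card (G \<union> (\<circ>) t ` G) = 2 * card G"
    using finG by (subst card_Un_disjoint) auto
  moreover have "G \<union> (\<circ>) t ` G \<subseteq> {g. g permutes {1..n}}"
    using sub assms(1) by (auto intro: permutes_compose)
  ultimately show ?thesis using card_mono[OF fin] by metis
qed

lemma (in perm_group_character) Re_sum_le_of_close:
  assumes "\<And>g. g permutes {1..n} \<Longrightarrow> cmod (P g - of_real q) \<le> q / 4" "0 \<le> q"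
  shows "Re (\<Sum>g \<in> G. c g * P g) \<le> Re (\<Sum>g | g permutes {1..n}. P g)"
proof -
  define S where "S = {g. g permutes {1..n}}"
  have sub: "G \<subseteq> S" using permutes by (auto simp: S_def)
  \<comment> \<open>In the first case the coefficients sum to \<open>n!\<close>, too much for
    \<open>perturbed_sum_le\<close>, but both sides coincide. In the others the sum is at most
    \<open>n!/2\<close> or is 0.\<close>
  consider "\<forall>g \<in> G. c g = 1" "G = S" | t where "\<forall>g \<in> G. c g = 1" "t \<in> S" "t \<notin> G"
    | "(\<Sum>g \<in> G. c g) = 0"
    using trivial_or_sum_0 sub by blast
  then show ?thesis
  proof cases
    case 1
    then have "(\<Sum>g \<in> G. c g * P g) = (\<Sum>g \<in> S. P g)" by simp
    then show ?thesis by (simp only: S_def order_refl)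
  next
    case 2
    have "2 * card G \<le> card S" using twice_card_le[of t] 2 by (simp add: S_def)
    then have "real (card G) \<le> card S / 2" by linarith
    then have "Re (\<Sum>g \<in> G. c g) \<le> card S / 2" using 2 by simp
    then show ?thesis
      using perturbed_sum_le[of S G c P q] sub norm_c_le assms
      by (simp add: S_def finite_permutations)
  next
    case 3
    then show ?thesis
      using perturbed_sum_le[of S G c P q] sub norm_c_le assms
      by (simp add: S_def finite_permutations)
  qed
qed

section \<open>Matrices of size at most three\<close>

lemma (in perm_group_character) Re_sum_le_of_nonneg:
  assumes P: "\<And>g. g permutes {1..n} \<Longrightarrow> Im (P g) = 0" "\<And>g. g permutes {1..n} \<Longrightarrow> 0 \<le> Re (P g)"
  shows "Re (\<Sum>g \<in> G. c g * P g) \<le> Re (\<Sum>g | g permutes {1..n}. P g)"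
proof -
  have "Re (\<Sum>g \<in> G. c g * P g) \<le> (\<Sum>g \<in> G. Re (P g))"
    unfolding Re_sum
  proof (rule sum_mono)
    fix g assume g: "g \<in> G"
    have "Re (c g) \<le> 1" using norm_c_le[OF g] complex_Re_le_cmod[of "c g"] by simp
    then show "Re (c g * P g) \<le> Re (P g)"
      using mult_right_mono[of "Re (c g)" 1 "Re (P g)"] P[OF permutes[OF g]] by simp
  qed
  also have "\<dots> \<le> (\<Sum>g | g permutes {1..n}. Re (P g))"
    using P(2) permutes by (intro sum_mono2) (auto simp: finite_permutations)
  finally show ?thesis unfolding Re_sum .
qed

text \<open>Row indices of \<open>R\<close> are meant to start at 1, so permutations of
  \<open>{1..n}\<close> apply to them without a shift; columns still start at 0.\<close>

definition gram :: "nat \<Rightarrow> (nat \<Rightarrow> nat \<Rightarrow> complex) \<Rightarrow> nat \<Rightarrow> nat \<Rightarrow> complex" where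
  "gram n R i j = (\<Sum>k<n. R i k * cnj (R j k))"

lemma gram_hermitian: "gram n R j i = cnj (gram n R i j)"
  by (simp add: gram_def mult.commute)

lemma gram_diag: "gram n R i i = of_real (\<Sum>k<n. (cmod (R i k))\<^sup>2)"
  unfolding gram_def of_real_sum by (intro sum.cong refl complex_norm_square[symmetric])

lemma gram_Cauchy_Schwarz:
  "(cmod (gram n R i j))\<^sup>2 \<le> (\<Sum>k<n. (cmod (R i k))\<^sup>2) * (\<Sum>k<n. (cmod (R j k))\<^sup>2)"
proof -
  have "cmod (gram n R i j) \<le> (\<Sum>k<n. cmod (R i k) * cmod (R j k))"
    unfolding gram_def by (rule order_trans[OF norm_sum]) (simp add: norm_mult)
  also have "\<dots> \<le> L2_set (\<lambda>k. cmod (R i k)) {..<n} * L2_set (\<lambda>k. cmod (R j k)) {..<n}"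
    using L2_set_mult_ineq[of "\<lambda>k. cmod (R i k)" "\<lambda>k. cmod (R j k)" "{..<n}"] by simp
  finally have "(cmod (gram n R i j))\<^sup>2
      \<le> (L2_set (\<lambda>k. cmod (R i k)) {..<n} * L2_set (\<lambda>k. cmod (R j k)) {..<n})\<^sup>2"
    by (intro power_mono) auto
  then show ?thesis by (simp add: power_mult_distrib L2_set_def sum_nonneg)
qed

text \<open>Every term is a nonnegative real: the identity gives a product of squared row norms, the
  transposition a squared modulus.\<close>

lemma (in perm_group_character) Re_gram_sum_le_2:
  assumes "1 \<le> n" "n \<le> 2"
  shows "Re (\<Sum>g \<in> G. c g * (\<Prod>i = 1..n. gram n R i (g i)))
    \<le> Re (\<Sum>g | g permutes {1..n}. \<Prod>i = 1..n. gram n R i (g i))"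
proof -
  have "\<exists>x. (\<Prod>i = 1..n. gram n R i (g i)) = of_real x \<and> 0 \<le> x" if g: "g permutes {1..n}" for g
  proof -
    consider "g = id" | "n = 2" "g = transpose 1 2"
    proof (cases "n = 1")
      case True
      then show thesis using g that by simp
    next
      case False
      then have "n = 2" using assms by simp
      moreover have "{1..2} = {1, 2 :: nat}" by auto
      ultimately show thesis using g that by (auto simp: permutes_doubleton_iff)
    qed
    then show ?thesis
    proof cases
      case 1
      have "(\<Prod>i = 1..n. gram n R i (id i)) = of_real (\<Prod>i = 1..n. \<Sum>k<n. (cmod (R i k))\<^sup>2)"
        by (simp add: gram_diag)
      moreover have "0 \<le> (\<Prod>i = 1..n. \<Sum>k<n. (cmod (R i k))\<^sup>2)"
        by (simp add: prod_nonneg sum_nonneg)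
      ultimately show ?thesis unfolding 1 by (intro exI conjI)
    next
      case 2
      have "(\<Prod>i = 1..n. gram n R i (g i)) = gram n R 1 2 * gram n R 2 1"
        using 2 by (simp add: eval_nat_numeral transpose_def)
      also have "\<dots> = of_real ((cmod (gram n R 1 2))\<^sup>2)"
        unfolding gram_hermitian[of n R 2 1] by (simp only: complex_norm_square)
      finally show ?thesis
        using zero_le_power2[of "cmod (gram n R 1 2)"] by (intro exI conjI)
    qed
  qed
  then have "Im (\<Prod>i = 1..n. gram n R i (g i)) = 0 \<and> 0 \<le> Re (\<Prod>i = 1..n. gram n R i (g i))"
    if "g permutes {1..n}" for g
    using that by (metis Im_complex_of_real Re_complex_of_real)
  then show ?thesis by (intro Re_sum_le_of_nonneg) simp_all
qed

section \<open>Real inequalities for size three\<close>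

lemma two_times_le_add_if_sq_le_mult:
  fixes p q x :: real
  assumes "x\<^sup>2 \<le> p * q" "0 \<le> p" "0 \<le> q"
  shows "2 * \<bar>x\<bar> \<le> p + q"
proof -
  have "(2 * \<bar>x\<bar>)\<^sup>2 \<le> (p + q)\<^sup>2"
    using assms(1) zero_le_power2[of "p - q"] by (simp add: power2_eq_square algebra_simps)
  moreover have "0 \<le> p + q" using assms(2,3) by simp
  ultimately show ?thesis by (rule power2_le_imp_le)
qed

lemma am_gm_3:
  fixes p q r :: real
  assumes "0 \<le> p" "0 \<le> q" "0 \<le> r"
  shows "27 * (p * q * r) \<le> (p + q + r) ^ 3"
proof -
  \<comment> \<open>The first summand on the right is p^3 + q^3 + r^3 - 3pqr.\<close>
  have "(p + q + r) ^ 3 - 27 * (p * q * r)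
      = (p + q + r) / 2 * ((p - q)\<^sup>2 + (q - r)\<^sup>2 + (p - r)\<^sup>2)
        + 3 * (p * (q - r)\<^sup>2 + q * (p - r)\<^sup>2 + r * (p - q)\<^sup>2)"
    by (simp add: power2_eq_square power3_eq_cube field_simps)
  moreover have "\<dots> \<ge> 0" using assms by (intro add_nonneg_nonneg mult_nonneg_nonneg) auto
  ultimately show ?thesis by linarith
qed

text \<open>The numbers below are those of a positive semidefinite \<open>3 \<times> 3\<close> matrix \<open>B\<close>:
  \<open>p\<close>, \<open>q\<close>, \<open>r\<close> are the terms of the permanent that belong to the transpositions,
  \<open>z\<close> is that of a 3-cycle, and \<open>D\<close> is the product of the diagonal; the determinant of \<open>B\<close>
  is \<open>D - (p + q + r) + 2 Re z\<close>.\<close>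

locale psd3_terms =
  fixes p q r D :: real and z :: complex
  assumes nonneg: "0 \<le> p" "0 \<le> q" "0 \<le> r" "0 \<le> D"
    and z_le: "(cmod z)\<^sup>2 \<le> p * q" "(cmod z)\<^sup>2 \<le> p * r" "(cmod z)\<^sup>2 \<le> q * r" "cmod z \<le> D"
    and pqr: "p * q * r = (cmod z)\<^sup>2 * D"
    and det: "0 \<le> D - (p + q + r) + 2 * Re z"
begin

lemma norm_z_le: "2 * cmod z \<le> p + q" "2 * cmod z \<le> p + r" "2 * cmod z \<le> q + r"
  using z_le two_times_le_add_if_sq_le_mult[of "cmod z"] nonneg by auto

lemma Re_z_ge: "- cmod z \<le> Re z"
  using abs_Re_le_cmod[of z] by linarith

text \<open>For a nontrivial character of the full group, \<open>t\<close> is the real value on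
  3-cycles. The worst case p + q + r = 3|z|, Re z = -|z| leaves (2 + 4t)|z|, hence the lower bound
  on \<open>t\<close>.\<close>

lemma class_function_ineq:
  fixes t :: real
  assumes "- 1 / 2 \<le> t" "t \<le> 1"
  shows "0 \<le> (4 + 2 * t) / 3 * (p + q + r) + 2 * (1 - t) * Re z"
proof -
  have "(4 + 2 * t) / 3 * (3 * cmod z) \<le> (4 + 2 * t) / 3 * (p + q + r)"
    using assms norm_z_le by (intro mult_left_mono) auto
  moreover have "2 * (1 - t) * (- cmod z) \<le> 2 * (1 - t) * Re z"
    using assms Re_z_ge by (intro mult_left_mono) auto
  moreover have "0 \<le> (2 + 4 * t) * cmod z" using assms by simp
  moreover have "(4 + 2 * t) / 3 * (3 * cmod z) + 2 * (1 - t) * (- cmod z) = (2 + 4 * t) * cmod z"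
    by (simp add: field_simps)
  ultimately show ?thesis by linarith
qed

text \<open>For the alternating group, \<open>w\<close> is the value on a 3-cycle. Let s = p + q +
  r. If \<open>s\<close> is small against \<open>D\<close>, AM-GM and \<open>pqr\<close> bound |z|
  by s / sqrt 12, and |1 - w| \<le> sqrt 3. If \<open>s\<close> is large, \<open>det\<close> and Re
  (wz) \<le> D make the expression at least 2s - 3D. Any threshold s/D between 3/2 and 9/4 separates
  the cases.\<close>

lemma cyclic_ineq:
  assumes "cmod w \<le> 1" "Re w = - 1 / 2"
  shows "0 \<le> p + q + r + 2 * Re ((1 - w) * z)"
proof (cases "p + q + r \<le> 9 / 4 * D")
  case True
  define s where "s = p + q + r"
  have "s \<ge> 0" using nonneg by (simp add: s_def)
  have "12 * (cmod z)\<^sup>2 \<le> s\<^sup>2"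
  \<comment> \<open>If \<open>D\<close> is 0, so is \<open>z\<close>, by \<open>z_le(4)\<close>;
    otherwise \<open>D\<close> can be cancelled.\<close>
  proof (cases "D = 0")
    case False
    have "27 * ((cmod z)\<^sup>2 * D) \<le> s\<^sup>2 * s"
      using am_gm_3[OF nonneg(1-3)] pqr by (simp add: s_def power2_eq_square power3_eq_cube)
    also have "\<dots> \<le> s\<^sup>2 * (9 / 4 * D)" using True unfolding s_def by (intro mult_left_mono) auto
    finally have "D * (12 * (cmod z)\<^sup>2) \<le> D * s\<^sup>2" by (simp add: algebra_simps)
    then show ?thesis using False nonneg(4) by simp
  qed (use z_le(4) in auto)
  moreover have "(cmod (1 - w))\<^sup>2 \<le> 3"
  proof -
    have "(cmod (1 - w))\<^sup>2 = 2 + (cmod w)\<^sup>2"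
      unfolding cmod_power2 using assms(2) by (simp add: power2_eq_square algebra_simps)
    moreover have "(cmod w)\<^sup>2 \<le> 1" using assms(1) by (simp add: power_le_one)
    ultimately show ?thesis by simp
  qed
  then have "4 * ((cmod (1 - w))\<^sup>2 * (cmod z)\<^sup>2) \<le> 4 * (3 * (cmod z)\<^sup>2)"
    by (intro mult_left_mono mult_right_mono) auto
  ultimately have "4 * ((cmod (1 - w))\<^sup>2 * (cmod z)\<^sup>2) \<le> s\<^sup>2" by linarith
  then have "(2 * cmod ((1 - w) * z))\<^sup>2 \<le> s\<^sup>2"
    by (simp add: norm_mult power_mult_distrib)
  then have "2 * cmod ((1 - w) * z) \<le> s" using \<open>s \<ge> 0\<close> by (rule power2_le_imp_le)
  then show ?thesis using abs_Re_le_cmod[of "(1 - w) * z"] by (simp add: s_def)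
next
  case False
  have "cmod (w * z) \<le> 1 * D"
    unfolding norm_mult using assms(1) z_le(4) by (intro mult_mono) auto
  then have "Re (w * z) \<le> D" using complex_Re_le_cmod[of "w * z"] by simp
  then show ?thesis using False det nonneg(4) by (simp add: left_diff_distrib)
qed

end

section \<open>Subgroups of the symmetric group on three points\<close>

lemma (in perm_group_character) Re_sum_le_3:
  fixes B :: "nat \<Rightarrow> nat \<Rightarrow> complex"
  assumes n: "n = 3"
    and psd: "psd3_terms p q r D z"
    and diag: "B 1 1 * B 2 2 * B 3 3 = of_real D"
    and transp: "B 1 2 * B 2 1 * B 3 3 = of_real p" "B 1 3 * B 2 2 * B 3 1 = of_real q"
      "B 1 1 * B 2 3 * B 3 2 = of_real r"
    and cyc: "B 1 2 * B 2 3 * B 3 1 = z" "B 1 3 * B 2 1 * B 3 2 = cnj z"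
  shows "Re (\<Sum>g \<in> G. c g * (\<Prod>i = 1..n. B i (g i)))
    \<le> Re (\<Sum>g | g permutes {1..n}. \<Prod>i = 1..n. B i (g i))"
proof -
  interpret psd3_terms p q r D z by fact
  define a b d s s' :: "nat \<Rightarrow> nat" where "a = transpose 1 2" and "b = transpose 1 3"
    and "d = transpose 2 3" and "s = a \<circ> d" and "s' = b \<circ> d"
  note defs = a_def b_def d_def s_def s'_def
  have ind: "{1..3} = {1, 2, 3 :: nat}" by auto
  have perms: "(\<Sum>g | g permutes {1..3}. f g) = f id + f d + f a + f s + f b + f s'"
    for f :: "(nat \<Rightarrow> nat) \<Rightarrow> complex"
    unfolding ind defs
    by (simp add: sum_over_permutations_insert add.assoc)
  have mult: "a \<circ> d = s" "d \<circ> a = s'" "a \<circ> b = s'" "b \<circ> a = s" "b \<circ> d = s'" "d \<circ> b = s"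
    "a \<circ> s = d" "s \<circ> a = b" "b \<circ> s' = d" "s' \<circ> b = a" "d \<circ> s' = a" "d \<circ> s = b"
    "s \<circ> s = s'" "s' \<circ> s' = s" "s \<circ> s' = id" "s' \<circ> s = id"
    "a \<circ> a = id" "b \<circ> b = id" "d \<circ> d = id"
    by (auto simp: fun_eq_iff defs transpose_def)
  have inv: "inv' a = a" "inv' b = b" "inv' d = d" "inv' s = s'"
    using mult by (auto intro!: inv_unique_comp)
  have prods: "(\<Prod>i = 1..3. B i (id i)) = of_real D" "(\<Prod>i = 1..3. B i (a i)) = of_real p"
    "(\<Prod>i = 1..3. B i (b i)) = of_real q" "(\<Prod>i = 1..3. B i (d i)) = of_real r"
    "(\<Prod>i = 1..3. B i (s i)) = z" "(\<Prod>i = 1..3. B i (s' i)) = cnj z"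
    unfolding ind defs using diag transp cyc by (simp_all add: transpose_def mult.assoc)
  \<comment> \<open>Extending \<open>c\<close> by 0 lets one formula over all six permutations cover
    every subgroup.\<close>
  define C where "C = (\<lambda>g. if g \<in> G then c g else 0)"
  have G: "G \<subseteq> {g. g permutes {1..3}}" using permutes n by auto
  have ext: "(\<Sum>g \<in> G. c g * f g) = (\<Sum>g | g permutes {1..3}. C g * f g)" for f
    using G by (intro sum.mono_neutral_cong_left) (auto simp: C_def finite_permutations)
  have real: "Im (C g) = 0" if "g \<in> {a, b, d}" for g
    using c_inv[of g] that inv by (auto simp: C_def complex_eq_iff)
  have le1: "Re (C g) \<le> 1" for g
    using norm_c_le[of g] complex_Re_le_cmod[of "c g"] by (auto simp: C_def)
  have Cid: "C id = 1" using id_mem c_id by (simp add: C_def)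
  have Cs': "C s' = cnj (C s)"
    using inv_mem[of s] inv_mem[of s'] c_inv[of s] inv(4) mult
    by (auto simp: C_def) (metis inv(4) inv_unique_comp)+
  have sum0: "(\<forall>g \<in> G. c g = 1) \<or> 1 + Re (C a) + Re (C b) + Re (C d) + 2 * Re (C s) = 0"
    using trivial_or_sum_0 ext[of "\<lambda>_. 1"] unfolding perms
    by (auto simp: Cid Cs' complex_eq_iff)
  \<comment> \<open>The identity terms cancel, and the two 3-cycles contribute conjugate
    numbers.\<close>
  have diff: "Re (\<Sum>g | g permutes {1..n}. \<Prod>i = 1..n. B i (g i))
      - Re (\<Sum>g \<in> G. c g * (\<Prod>i = 1..n. B i (g i)))
    = (1 - Re (C a)) * p + (1 - Re (C b)) * q + (1 - Re (C d)) * r + 2 * Re ((1 - C s) * z)"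
    unfolding n ext perms prods Cid Cs' by (simp add: algebra_simps)
  have trans0: "(1 - Re (C a)) * p \<ge> 0" "(1 - Re (C b)) * q \<ge> 0" "(1 - Re (C d)) * r \<ge> 0"
    using le1 nonneg by simp_all
  have "0 \<le> (1 - Re (C a)) * p + (1 - Re (C b)) * q + (1 - Re (C d)) * r + 2 * Re ((1 - C s) * z)"
  proof (cases "s \<in> G")
    case False
    then have "s' \<notin> G" using mult comp_mem by metis
    \<comment> \<open>Two different transpositions compose to a 3-cycle. So at least two are missing
      from \<open>G\<close>, and their full terms absorb 2|z| by \<open>norm_z_le\<close>.\<close>
    then have two: "a \<notin> G \<and> b \<notin> G \<or> a \<notin> G \<and> d \<notin> G \<or> b \<notin> G \<and> d \<notin> G"
      using mult comp_mem by metis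
    have "C s = 0" using False by (simp add: C_def)
    then show ?thesis
      using two trans0 norm_z_le Re_z_ge by (auto simp: C_def)
  next
    case s: True
    then have s': "s' \<in> G" using mult comp_mem by metis
    have Cs: "Re (C s) \<ge> - 1 / 2" "cmod (C s) \<le> 1"
      using order_3[OF s] norm_c_le[OF s] s mult by (auto simp: C_def)
    consider "\<forall>g \<in> G. c g = 1" | "1 + Re (C a) + Re (C b) + Re (C d) + 2 * Re (C s) = 0"
      using sum0 by blast
    then show ?thesis
    proof cases
      case 1
      then have "C s = 1" using s by (simp add: C_def)
      then show ?thesis using trans0 by simp
    next
      case sum: 2
      show ?thesis
      proof (cases "a \<in> G \<or> b \<in> G \<or> d \<in> G")
        case True
        \<comment> \<open>A transposition and a 3-cycle generate the whole group.\<close>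
        then have all: "a \<in> G" "b \<in> G" "d \<in> G" using s s' mult comp_mem by metis+
        \<comment> \<open>Products in the two orders give conjugate elements; the last equation and
          \<open>Cs'\<close> make \<open>C s\<close> real.\<close>
        have "c d = c b" "c d = c a" "c s = c s'"
          using c_commute[OF all(1) s] c_commute[OF all(2) s'] c_commute[OF all(1) all(3)] mult by auto
        then have eqs: "Re (C a) = Re (C d)" "Re (C b) = Re (C d)" "Im (C s) = 0"
          using all s s' Cs' by (auto simp: C_def complex_eq_iff)
        \<comment> \<open>With common value \<open>u\<close> on transpositions and \<open>t\<close>
          on 3-cycles, the vanishing sum reads 1 + 3u + 2t = 0.\<close>
        then have coeff: "1 - Re (C d) = (4 + 2 * Re (C s)) / 3" using sum by simp
        have "0 \<le> (1 - Re (C d)) * (p + q + r) + 2 * (1 - Re (C s)) * Re z"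
          unfolding coeff by (rule class_function_ineq[OF Cs(1) le1])
        then show ?thesis using eqs by (simp add: algebra_simps)
      next
        case False
        \<comment> \<open>Here \<open>G\<close> is the alternating group, and the vanishing sum
          fixes the real part on 3-cycles.\<close>
        then have 0: "C a = 0" "C b = 0" "C d = 0" by (auto simp: C_def)
        then have "Re (C s) = - 1 / 2" using sum by simp
        then show ?thesis using cyclic_ineq[OF Cs(2)] 0 by simp
      qed
    qed
  qed
  then show ?thesis using diff by linarith
qed

lemma (in perm_group_character) Re_gram_sum_le_3:
  assumes n: "n = 3"
    and low: "\<And>i k. i \<in> {1..n} \<Longrightarrow> k < n \<Longrightarrow> i \<le> k \<Longrightarrow> R i k = 0"
  shows "Re (\<Sum>g \<in> G. c g * (\<Prod>i = 1..n. gram n R i (g i)))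
    \<le> Re (\<Sum>g | g permutes {1..n}. \<Prod>i = 1..n. gram n R i (g i))"
proof -
  define x where "x = (\<lambda>i. \<Sum>k<3. (cmod (R i k))\<^sup>2)"
  define B where "B = gram 3 R"
  define y where "y = (\<lambda>i j. (cmod (B i j))\<^sup>2)"
  have x: "0 \<le> x i" for i by (simp add: x_def sum_nonneg)
  have y: "0 \<le> y i j" for i j by (simp add: y_def)
  have yx: "y i j \<le> x i * x j" for i j
    using gram_Cauchy_Schwarz[of 3 R i j] by (simp add: y_def B_def x_def)
  have diag: "B i i = of_real (x i)" for i by (simp add: B_def x_def gram_diag)
  have herm: "B j i = cnj (B i j)" for i j unfolding B_def by (rule gram_hermitian)
  have BB: "B i j * B j i = of_real (y i j)" for i j
    unfolding herm[of j i] y_def by (simp only: complex_norm_square)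
  define D p q r where "D = x 1 * x 2 * x 3" and "p = y 1 2 * x 3" and "q = y 1 3 * x 2"
    and "r = y 2 3 * x 1"
  define z where "z = B 1 2 * B 2 3 * B 3 1"
  have z2: "(cmod z)\<^sup>2 = y 1 2 * y 2 3 * y 1 3"
    unfolding z_def y_def herm[of 3 1] norm_mult power_mult_distrib complex_mod_cnj ..
  have terms: "B 1 1 * B 2 2 * B 3 3 = of_real D"
    "B 1 2 * B 2 1 * B 3 3 = of_real p" "B 1 3 * B 2 2 * B 3 1 = of_real q"
    "B 1 1 * B 2 3 * B 3 2 = of_real r"
    "B 1 2 * B 2 3 * B 3 1 = z" "B 1 3 * B 2 1 * B 3 2 = cnj z"
  proof -
    have "B 1 3 * B 2 2 * B 3 1 = (B 1 3 * B 3 1) * B 2 2" by (simp only: mult_ac)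
    then show "B 1 3 * B 2 2 * B 3 1 = of_real q" by (simp only: BB diag q_def of_real_mult)
    have "B 1 1 * B 2 3 * B 3 2 = (B 2 3 * B 3 2) * B 1 1" by (simp only: mult_ac)
    then show "B 1 1 * B 2 3 * B 3 2 = of_real r" by (simp only: BB diag r_def of_real_mult)
    show "B 1 3 * B 2 1 * B 3 2 = cnj z"
      unfolding z_def herm[of 2 1] herm[of 3 2] herm[of 3 1] complex_cnj_mult complex_cnj_cnj
      by (simp only: mult_ac)
  qed (simp_all only: BB diag p_def D_def of_real_mult z_def)
  have R0: "R (Suc 0) (Suc 0) = 0" "R (Suc 0) 2 = 0" "R 2 2 = 0"
    using low[of 1 1] low[of 1 2] low[of 2 2] n by auto
  have sum3: "(\<Sum>k<3. f k) = f 0 + f (Suc 0) + f 2" for f :: "nat \<Rightarrow> complex"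
    by (simp add: eval_nat_numeral)
  \<comment> \<open>The left side is the determinant of \<open>B\<close>, the right side the squared
    modulus of the determinant of the triangular factor, whose diagonal entries are
    \<open>R 1 0\<close>, \<open>R 2 1\<close> and \<open>R 3 2\<close>.\<close>
  have "of_real (D - (p + q + r)) + (z + cnj z)
      = (R 1 0 * cnj (R 1 0)) * (R 2 1 * cnj (R 2 1)) * (R 3 2 * cnj (R 3 2))"
    unfolding of_real_diff of_real_add terms[symmetric] B_def gram_def sum3
    by (simp add: R0 algebra_simps)
  also have "\<dots> = of_real ((cmod (R 1 0))\<^sup>2 * (cmod (R 2 1))\<^sup>2 * (cmod (R 3 2))\<^sup>2)"
    by (simp only: complex_norm_square of_real_mult)
  also have "z + cnj z = of_real (2 * Re z)" by (simp add: complex_add_cnj)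
  finally have "D - (p + q + r) + 2 * Re z = (cmod (R 1 0))\<^sup>2 * (cmod (R 2 1))\<^sup>2 * (cmod (R 3 2))\<^sup>2"
    unfolding of_real_add[symmetric] of_real_eq_iff .
  then have det: "0 \<le> D - (p + q + r) + 2 * Re z" by simp
  have "psd3_terms p q r D z"
  proof
    show "0 \<le> p" "0 \<le> q" "0 \<le> r" "0 \<le> D" using x y by (simp_all add: p_def q_def r_def D_def)
    \<comment> \<open>Here and in the next two bounds, Cauchy-Schwarz trades one of the three
      factors of \<open>z2\<close> for two diagonal entries.\<close>
    show "(cmod z)\<^sup>2 \<le> p * q"
      using mult_left_mono[OF yx[of 2 3], of "y 1 2 * y 1 3"] y unfolding z2
      by (simp add: p_def q_def mult_ac)
    show "(cmod z)\<^sup>2 \<le> p * r"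
      using mult_left_mono[OF yx[of 1 3], of "y 1 2 * y 2 3"] y unfolding z2
      by (simp add: p_def r_def mult_ac)
    show "(cmod z)\<^sup>2 \<le> q * r"
      using mult_left_mono[OF yx[of 1 2], of "y 1 3 * y 2 3"] y unfolding z2
      by (simp add: q_def r_def mult_ac)
    have "(cmod z)\<^sup>2 \<le> (x 1 * x 2) * (x 2 * x 3) * (x 1 * x 3)"
      unfolding z2 using x y yx by (intro mult_mono) auto
    also have "\<dots> = D\<^sup>2" by (simp add: D_def power2_eq_square mult_ac)
    finally show "cmod z \<le> D"
      using x by (intro power2_le_imp_le[of "cmod z" D]) (simp_all add: D_def)
    show "p * q * r = (cmod z)\<^sup>2 * D"
      unfolding z2 by (simp add: p_def q_def r_def D_def mult_ac)
  qed (rule det)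
  from Re_sum_le_3[OF n this terms] show ?thesis unfolding B_def n .
qed

section \<open>Permanent dominance\<close>

lemma mult_mat_adjoint_eq_gram:
  assumes "L \<in> carrier_mat n n" "i \<in> {1..n}" "j \<in> {1..n}"
  shows "(L * mat_adjoint L) $$ (i - 1, j - 1) = gram n (\<lambda>i k. L $$ (i - 1, k)) i j"
  using assms
  by (auto simp: mat_adjoint_def mat_of_rows_def scalar_prod_def gram_def atLeast0LessThan)

theorem corollary3p7:
  fixes n :: nat
    and L A :: "complex mat"
    and G :: "(nat \<Rightarrow> nat) set"
    and \<chi> :: "(nat \<Rightarrow> nat) \<Rightarrow> complex"
  assumes "1 \<le> n"
    and "L \<in> carrier_mat n n"
    and "\<And>i j. i < j \<Longrightarrow> j < n \<Longrightarrow> L $$ (i, j) = 0"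
    and "A = L * mat_adjoint L"
    and "\<And>k j. 3 < n \<Longrightarrow> k < n \<Longrightarrow> j < n \<Longrightarrow> j \<noteq> 0 \<Longrightarrow> cmod (L $$ (k, j)) \<le> eps_bound n L"
    and "subgroup G (sym_group n)"
    and "irreducible_character (sym_group n \<lparr>carrier := G\<rparr>) \<chi>"
  shows "normalized_gen_matrix_function G \<chi> A \<le> permanent A"
proof -
  define R where "R = (\<lambda>i k. L $$ (i - 1, k))"
  define P where "P = (\<lambda>g. \<Prod>i = 1..n. gram n R i (g i))"
  define c where "c = (\<lambda>g. \<chi> g / \<chi> id)"
  interpret G: perm_group_character n G c
    unfolding c_def by (rule irreducible_character_perm_group[OF assms(6,7)])
  \<comment> \<open>The permanent is the case of the full group with trivial character, so
    \<open>Im_hermitian_sum\<close> also shows that it is real; the complex order demands equal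
    imaginary parts.\<close>
  interpret S: perm_group_character n "{g. g permutes {1..n}}" "\<lambda>_. 1"
    by unfold_locales (auto intro: permutes_compose permutes_inv permutes_id)
  have dim: "dim_row A = n" using assms(2,4) by simp
  have low: "R i k = 0" if "i \<in> {1..n}" "k < n" "i \<le> k" for i k
    using assms(3)[of "i - 1" k] that by (simp add: R_def)
  have prod: "(\<Prod>i = 1..n. A $$ (i - 1, g i - 1)) = P g" if g: "g permutes {1..n}" for g
  proof -
    have "g i \<in> {1..n}" if "i \<in> {1..n}" for i using permutes_in_image[OF g] that by blast
    then show ?thesis
      unfolding P_def R_def assms(4)
      by (intro prod.cong refl mult_mat_adjoint_eq_gram[OF assms(2)])
  qed
  have lhs: "normalized_gen_matrix_function G \<chi> A = (\<Sum>g \<in> G. c g * P g)"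
    unfolding normalized_gen_matrix_function_def gen_matrix_function_def dim sum_distrib_left
    using prod G.permutes by (intro sum.cong) (auto simp: c_def)
  have rhs: "permanent A = (\<Sum>g | g permutes {1..n}. P g)"
    unfolding permanent_def dim using prod by (intro sum.cong) (auto simp: sym_group_carrier)
  have "Im (\<Sum>g \<in> G. c g * P g) = 0"
    unfolding P_def by (rule G.Im_hermitian_sum) (rule gram_hermitian)
  moreover have "Im (\<Sum>g | g permutes {1..n}. 1 * P g) = 0"
    unfolding P_def by (rule S.Im_hermitian_sum) (rule gram_hermitian)
  moreover have "Re (\<Sum>g \<in> G. c g * P g) \<le> Re (\<Sum>g | g permutes {1..n}. P g)"
  proof -
    consider "n \<le> 2" | "n = 3" | "3 < n" by linarith
    then show ?thesis
    proof cases
      case 1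
      show ?thesis unfolding P_def by (rule G.Re_gram_sum_le_2[OF assms(1) 1])
    next
      case 2
      show ?thesis unfolding P_def by (rule G.Re_gram_sum_le_3[OF 2 low])
    next
      case 3
      define a0 where "a0 = Max ((\<lambda>i. cmod (L $$ (i, 0))) ` {..<n})"
      note eps = eps_bound_properties[where L = L, OF 3, folded a0_def]
      have idx: "i - 1 < n" if "i \<in> {1..n}" for i
      proof -
        from that have "1 \<le> i" "i \<le> n" by auto
        then show ?thesis by linarith
      qed
      have shift: "(\<Prod>i<n. cmod (L $$ (i, 0))) = (\<Prod>i = 1..n. cmod (R i 0))"
        unfolding R_def
        by (rule prod.reindex_bij_witness[of _ "\<lambda>i. i - 1" Suc]) auto
      show ?thesis
      proof (rule G.Re_sum_le_of_close)
        fix g assume g: "g permutes {1..n}"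
        \<comment> \<open>The common centre is the square of the product of the first column's
          moduli; the error bound is at most a quarter of it by \<open>eps(4)\<close>.\<close>
        have "cmod (P g - of_real ((\<Prod>i = 1..n. cmod (R i 0))\<^sup>2))
            \<le> fact n * (a0 ^ (n - 1) * eps_bound n L)\<^sup>2"
          unfolding P_def gram_def of_real_power[symmetric]
        proof (rule gram_product_approx[OF g low _ _ eps(2,3)])
          show "cmod (R i 0) \<le> a0" if "i \<in> {1..n}" for i
            unfolding R_def by (rule eps(1)[OF idx[OF that]])
          show "cmod (R i k) \<le> eps_bound n L" if "i \<in> {1..n}" "k < n" "k \<noteq> 0" for i k
            unfolding R_def by (rule assms(5)[OF 3 idx[OF that(1)] that(2,3)])
        qed
        then show "cmod (P g - of_real ((\<Prod>i = 1..n. cmod (R i 0))\<^sup>2))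
            \<le> (\<Prod>i = 1..n. cmod (R i 0))\<^sup>2 / 4"
          using eps(4) unfolding shift by linarith
      qed simp
    qed
  qed
  ultimately show ?thesis
    unfolding lhs rhs by (simp add: less_eq_complex_def)
qed

end
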